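(* Let $u$ be a power of two, $r$ an integer with $1<r\le u/2$, and $p=2^b-1>u$ a Mersenne prime. Let $h:[u]\to[2^b-1]$ be a 4-universal hash function. For each key $x\in[u]$ set $h_x=h(x)+1$, $j_x=h_x\bmod 2^{b-1}$, $i_x=\lfloor rj_x/2^{b-1}\rfloor\in[r]$, $a_x=\lfloor h_x/2^{b-1}\rfloor$ and $s_x=1-2a_x\in\{-1,1\}$. Let $f\in\mathbb Z^u$ be fixed, $n$ the number of $x$ with $f_x\neq0$, $F_m=\sum_{x\in[u]}f_x^m$, $C_t=\sum_{x\in[u]}s_xf_x[i_x=t]$ for $t\in[r]$, and $X=\sum_{t\in[r]}C_t^2$. Then $$\mathbb E[X]=F_2+(F_1^2-F_2)/p^2,\qquad |\mathbb E[X]-F_2|\le F_2(n-1)/p^2,\qquad \operatorname{Var}[X]<2\big(1+(r/2^b)^2\big)F_2^2/r.$$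
   Context: $[m]=\{0,\ldots,m-1\}$; $[P]$ is $1$ if $P$ holds and $0$ otherwise. A random hash function $h:U\to R$ is $k$-universal if for any $k$ distinct keys $x_0,\ldots,x_{k-1}\in U$, the tuple $(h(x_0),\ldots,h(x_{k-1}))$ is uniformly distributed on $R^k$. (The $C_t$ are the counters of the Count Sketch with bucket function $i$ and sign function $s$.)
   Formalization: The strict variance bound is stated only for f not identically zero on [u]; for f = 0 both Var[X] and the right-hand side are 0, so the strict inequality fails. The other two claims hold for every f. *)

theory Defs
  imports "HOL-Probability.Probability" "HOL-Computational_Algebra.Primes"
begin

text \<open>
  A random function is a family \<open>h x\<close> of random variables on the probability space \<open>M\<close>,
  indexed by the keys \<open>x\<close>. A tuple in \<open>R\<^sup>k\<close> is a list of length \<open>k\<close> over \<open>R\<close>.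
\<close>

definition k_universal ::
  "'w measure \<Rightarrow> nat \<Rightarrow> 'k set \<Rightarrow> 'r set \<Rightarrow> ('k \<Rightarrow> 'w \<Rightarrow> 'r) \<Rightarrow> bool" where
  "k_universal M k U R h \<longleftrightarrow>
     (\<forall>x\<in>U. h x \<in> M \<rightarrow>\<^sub>M count_space R) \<and>
     (\<forall>xs. length xs = k \<and> distinct xs \<and> set xs \<subseteq> U \<longrightarrow>
        distr M (count_space {ys. length ys = k \<and> set ys \<subseteq> R}) (\<lambda>\<omega>. map (\<lambda>x. h x \<omega>) xs) =
        uniform_count_measure {ys. length ys = k \<and> set ys \<subseteq> R})"

text \<open>
  The functions below split a \<open>b\<close>-bit value \<open>v\<close> into its low \<open>b - 1\<close> bits, which give the
  bucket, and its top bit, which gives the sign.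
\<close>

definition bucket_of :: "nat \<Rightarrow> nat \<Rightarrow> nat \<Rightarrow> nat" where
  "bucket_of b r v = (r * (v mod 2 ^ (b - 1))) div 2 ^ (b - 1)"

definition sign_of :: "nat \<Rightarrow> nat \<Rightarrow> int" where
  "sign_of b v = 1 - 2 * int (v div 2 ^ (b - 1))"

lemma bucket_of_less: "0 < r \<Longrightarrow> bucket_of b r v < r"
  by (simp add: bucket_of_def less_mult_imp_div_less)

lemma sign_of_cases:
  assumes "0 < b" "v < 2 ^ b"
  shows "sign_of b v \<in> {-1, 1}"
proof -
  have "(2::nat) ^ b = 2 * 2 ^ (b - 1)"
    using assms(1) by (cases b) auto
  then have "v div 2 ^ (b - 1) < 2"
    using assms(2) by (simp add: less_mult_imp_div_less)
  then show ?thesis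
    unfolding sign_of_def by (auto simp: less_2_cases_iff)
qed

definition counter :: "nat \<Rightarrow> (nat \<Rightarrow> int) \<Rightarrow> (nat \<Rightarrow> nat) \<Rightarrow> (nat \<Rightarrow> int) \<Rightarrow> nat \<Rightarrow> int" where
  "counter u s i f t = (\<Sum>x<u. s x * f x * of_bool (i x = t))"

definition sketch_estimate ::
  "nat \<Rightarrow> nat \<Rightarrow> (nat \<Rightarrow> int) \<Rightarrow> (nat \<Rightarrow> nat) \<Rightarrow> (nat \<Rightarrow> int) \<Rightarrow> int" where
  "sketch_estimate u r s i f = (\<Sum>t<r. (counter u s i f t)\<^sup>2)"

text \<open>
  The keys are hashed to \<open>{0..<2^b - 1}\<close>; adding one moves the range to the nonzero
  \<open>b\<close>-bit values.
\<close>

definition mersenne_estimate ::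
  "nat \<Rightarrow> nat \<Rightarrow> nat \<Rightarrow> (nat \<Rightarrow> 'w \<Rightarrow> nat) \<Rightarrow> (nat \<Rightarrow> int) \<Rightarrow> 'w \<Rightarrow> real" where
  "mersenne_estimate u r b h f \<omega> =
     real_of_int (sketch_estimate u r
       (\<lambda>x. sign_of b (h x \<omega> + 1)) (\<lambda>x. bucket_of b r (h x \<omega> + 1)) f)"

definition freq_moment :: "nat \<Rightarrow> (nat \<Rightarrow> int) \<Rightarrow> nat \<Rightarrow> real" where
  "freq_moment u f m = real_of_int (\<Sum>x<u. f x ^ m)"

definition num_nonzero :: "nat \<Rightarrow> (nat \<Rightarrow> int) \<Rightarrow> nat" where
  "num_nonzero u f = card {x. x < u \<and> f x \<noteq> 0}"

end

theory Submission
  imports Defs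
begin

text \<open>
  Write \<open>X = F\<^sub>2 + Y\<close> with
  \<open>Y = (\<Sum>x \<noteq> y. f x f y K (h x) (h y))\<close> and
  \<open>K v w = s\<^sub>v s\<^sub>w [i\<^sub>v = i\<^sub>w]\<close>. Under 4-universality the mean and
  variance of \<open>Y\<close> depend only on \<open>\<Sum>K\<close>, \<open>\<Sum>K\<^sup>2\<close> and the
  squared row sums of \<open>K\<close>: pairs of keys that are disjoint are uncorrelated, and pairs sharing
  one or two keys contribute the triple and the main term. Over all \<open>2\<^sup>b\<close> values the signs in
  each bucket would cancel; since the value \<open>0\<close> (bucket \<open>0\<close>, sign \<open>+1\<close>) is
  missing, the signed size of bucket \<open>t\<close> is \<open>-[t = 0]\<close>, so \<open>\<Sum>K = 1\<close>.
  With \<open>N\<^sub>t\<close> the bucket sizes, \<open>\<Sum>K\<^sup>2 = \<Sum>N\<^sub>t\<^sup>2\<close>, which is at most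
  \<open>(p\<^sup>2 + r (r - 1)) / r\<close>. The triple term is positive, but
  is absorbed by \<open>- F\<^sub>4 \<le> - F\<^sub>2\<^sup>2 / n\<close> because \<open>n \<le> u \<le> 2\<^sup>b / 2\<close>.
\<close>

section \<open>Sums over pairs of distinct keys and power-sum inequalities\<close>

lemma sum_distinct_pairs:
  fixes f :: "'k \<Rightarrow> 'k \<Rightarrow> real"
  assumes "finite U"
  shows "(\<Sum>x\<in>U. \<Sum>y\<in>U - {x}. f x y) = (\<Sum>x\<in>U. \<Sum>y\<in>U. f x y) - (\<Sum>x\<in>U. f x x)"
  using assms by (simp add: sum_diff1 sum_subtractf)

text \<open>Here \<open>C z w\<close> stands for the covariance of a fixed pair
  \<open>(x, y)\<close> with the pair \<open>(z, w)\<close>. Two ordered pairs consist of the keys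
  \<open>x\<close> and \<open>y\<close>; a pair sharing just one of them has it in either position,
  which gives the second factor 2.\<close>

lemma sum_pairs_meeting_pair:
  fixes f :: "'k \<Rightarrow> real" and C :: "'k \<Rightarrow> 'k \<Rightarrow> real"
  assumes "finite U" "x \<in> U" "y \<in> U" "x \<noteq> y"
    and same: "C x y = \<alpha>" "C y x = \<alpha>"
    and one: "\<And>z. z \<in> U - {x, y} \<Longrightarrow> C x z = \<beta> \<and> C y z = \<beta> \<and> C z x = \<beta> \<and> C z y = \<beta>"
    and none: "\<And>z w. z \<in> U - {x, y} \<Longrightarrow> w \<in> U - {x, y} \<Longrightarrow> z \<noteq> w \<Longrightarrow> C z w = 0"
  shows "(\<Sum>z\<in>U. \<Sum>w\<in>U - {z}. f z * f w * C z w) =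
    2 * \<alpha> * (f x * f y) + 2 * \<beta> * ((f x + f y) * (sum f U - f x - f y))"
proof -
  define V where "V = U - {x, y}"
  have V: "finite V" "x \<notin> V" "y \<notin> V" and U: "U = insert x (insert y V)"
    using assms by (auto simp: V_def)
  have S: "sum f U - f x - f y = sum f V"
    using V assms(4) unfolding U by simp
  have "U - {x} = insert y V" "U - {y} = insert x V"
    using V assms(4) unfolding U by auto
  then have xy: "(\<Sum>w\<in>U - {x}. f x * f w * C x w) = \<alpha> * (f x * f y) + \<beta> * (f x * sum f V)"
    "(\<Sum>w\<in>U - {y}. f y * f w * C y w) = \<alpha> * (f x * f y) + \<beta> * (f y * sum f V)"
    using V same one by (simp_all add: V_def[symmetric] sum_distrib_left mult_ac)
  have z: "(\<Sum>w\<in>U - {z}. f z * f w * C z w) = \<beta> * (f z * (f x + f y))" if "z \<in> V" for z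
  proof -
    have "U - {z} = insert x (insert y (V - {z}))"
      using V that unfolding U by auto
    moreover have "(\<Sum>w\<in>V - {z}. f z * f w * C z w) = 0"
      using none that by (intro sum.neutral) (auto simp: V_def)
    ultimately show ?thesis
      using V assms(4) one that by (simp add: V_def[symmetric] algebra_simps)
  qed
  have "(\<Sum>z\<in>U. \<Sum>w\<in>U - {z}. f z * f w * C z w) =
      (\<alpha> * (f x * f y) + \<beta> * (f x * sum f V)) + ((\<alpha> * (f x * f y) + \<beta> * (f y * sum f V)) +
      (\<Sum>z\<in>V. \<beta> * (f z * (f x + f y))))"
    using V assms(4) unfolding xy[symmetric] by (subst U) (simp add: z)
  also have "(\<Sum>z\<in>V. \<beta> * (f z * (f x + f y))) = \<beta> * (sum f V * (f x + f y))"
    by (simp add: sum_distrib_left sum_distrib_right)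
  finally show ?thesis
    unfolding S by (simp add: algebra_simps)
qed

lemma cauchy_schwarz_card:
  fixes f :: "'k \<Rightarrow> real"
  shows "(\<Sum>x\<in>A. f x)\<^sup>2 \<le> real (card A) * (\<Sum>x\<in>A. (f x)\<^sup>2)"
  using Cauchy_Schwarz_ineq_sum[of "\<lambda>_. 1" f A] by simp

definition power_sum :: "'k set \<Rightarrow> ('k \<Rightarrow> real) \<Rightarrow> nat \<Rightarrow> real" where
  "power_sum U f m = (\<Sum>x\<in>U. f x ^ m)"

text \<open>This is the sum of \<open>(f x)\<^sup>2 * f y * f z\<close> over triples of distinct
  keys: the inner bracket is the square of a sum minus its diagonal.\<close>

definition triple_sum :: "'k set \<Rightarrow> ('k \<Rightarrow> real) \<Rightarrow> real" where
  "triple_sum U f =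
    (\<Sum>x\<in>U. (f x)\<^sup>2 * ((power_sum U f 1 - f x)\<^sup>2 - (power_sum U f 2 - (f x)\<^sup>2)))"

text \<open>The \<open>\<beta>\<close> factor is 4 because the shared key may be in either position
  of both ordered pairs. Both sides are compared as polynomials in the power sums, with the diagonal
  \<open>x = y\<close> subtracted.\<close>

lemma sum_pair_weights:
  fixes f :: "'k \<Rightarrow> real"
  assumes "finite U"
  shows "(\<Sum>x\<in>U. \<Sum>y\<in>U - {x}. f x * f y *
      (2 * \<alpha> * (f x * f y) + 2 * \<beta> * ((f x + f y) * (power_sum U f 1 - f x - f y)))) =
    2 * \<alpha> * ((power_sum U f 2)\<^sup>2 - power_sum U f 4) + 4 * \<beta> * triple_sum U f"
proof -
  define S where "S = power_sum U f 1"
  let ?P = "power_sum U f"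
  let ?g = "\<lambda>x y. f x * f y *
      (2 * \<alpha> * (f x * f y) + 2 * \<beta> * ((f x + f y) * (S - f x - f y)))"
  have e: "?g x y = (2*\<alpha> - 4*\<beta>) * (f x ^ 2 * f y ^ 2) + 2 * \<beta> * S * (f x ^ 2 * f y ^ 1)
      + 2 * \<beta> * S * (f x ^ 1 * f y ^ 2) - 2 * \<beta> * (f x ^ 3 * f y ^ 1) - 2 * \<beta> * (f x ^ 1 * f y ^ 3)" for x y
    by (simp add: algebra_simps eval_nat_numeral)
  have d: "?g x x = (2*\<alpha> - 8*\<beta>) * f x ^ 4 + 4 * \<beta> * S * f x ^ 3" for x
    by (simp add: algebra_simps eval_nat_numeral)
  have 1: "(\<Sum>x\<in>U. \<Sum>y\<in>U. ?g x y) = (2*\<alpha> - 4*\<beta>) * (?P 2 * ?P 2) + 4 * \<beta> * S * (?P 2 * ?P 1)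
     - 4 * \<beta> * (?P 3 * ?P 1)"
    unfolding e sum.distrib sum_subtractf sum_distrib_left[symmetric] sum_distrib_right[symmetric]
      power_sum_def[symmetric] by (simp add: algebra_simps)
  have 2: "(\<Sum>x\<in>U. ?g x x) = (2*\<alpha> - 8*\<beta>) * ?P 4 + 4 * \<beta> * S * ?P 3"
    unfolding d sum.distrib sum_distrib_left[symmetric] power_sum_def ..
  have "(f x)\<^sup>2 * ((S - f x)\<^sup>2 - (?P 2 - (f x)\<^sup>2)) =
      (S\<^sup>2 - ?P 2) * f x ^ 2 - 2 * S * f x ^ 3 + 2 * f x ^ 4" for x
    by (simp add: algebra_simps eval_nat_numeral)
  then have 3: "triple_sum U f = (S\<^sup>2 - ?P 2) * ?P 2 - 2 * S * ?P 3 + 2 * ?P 4"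
    unfolding triple_sum_def S_def[symmetric]
    by (simp add: power_sum_def sum.distrib sum_subtractf sum_distrib_left)
  show ?thesis
    unfolding S_def[symmetric] sum_distinct_pairs[OF assms] 1 2 3
    by (simp add: S_def[symmetric] algebra_simps power2_eq_square)
qed

text \<open>For a key \<open>x\<close> of the support, Cauchy-Schwarz over the other
  \<open>n - 1\<close> support keys bounds \<open>(power_sum U f 1 - f x)\<^sup>2\<close>; removing
  the diagonal turns \<open>n - 1\<close> into \<open>n - 2\<close>.\<close>

lemma triple_sum_le:
  fixes f :: "'k \<Rightarrow> real"
  assumes "finite U"
  defines "n \<equiv> card {x \<in> U. f x \<noteq> 0}"
  shows "triple_sum U f \<le> (real n - 2) * ((power_sum U f 2)\<^sup>2 - power_sum U f 4)"
proof -
  let ?P = "power_sum U f"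
  have "(f x)\<^sup>2 * ((?P 1 - f x)\<^sup>2 - (?P 2 - (f x)\<^sup>2)) \<le>
      (f x)\<^sup>2 * ((real n - 2) * (?P 2 - (f x)\<^sup>2))" if "x \<in> U" for x
  proof (cases "f x = 0")
    case False
    define A where "A = {x \<in> U. f x \<noteq> 0}"
    have A: "finite A" "x \<in> A" "A \<subseteq> U" using assms that False by (auto simp: A_def)
    have P: "?P m = (\<Sum>x\<in>A. f x ^ m)" if "0 < m" for m
      unfolding power_sum_def using assms(1) that by (intro sum.mono_neutral_right) (auto simp: A_def)
    have "card A = n" by (simp add: A_def n_def)
    then have "real (card (A - {x})) = real n - 1"
      using A by (metis card_Diff_singleton card_gt_0_iff empty_iff of_nat_diff of_nat_1 Suc_leI One_nat_def)
    then have "(?P 1 - f x)\<^sup>2 \<le> (real n - 1) * (?P 2 - (f x)\<^sup>2)"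
      using cauchy_schwarz_card[of f "A - {x}"] A by (simp add: P sum_diff1)
    then show ?thesis
      by (intro mult_left_mono) (auto simp: algebra_simps)
  qed simp
  then have "triple_sum U f \<le> (\<Sum>x\<in>U. (f x)\<^sup>2 * ((real n - 2) * (?P 2 - (f x)\<^sup>2)))"
    unfolding triple_sum_def by (rule sum_mono)
  also have "\<dots> = (\<Sum>x\<in>U. (real n - 2) * ?P 2 * f x ^ 2 - (real n - 2) * f x ^ 4)"
    by (intro sum.cong) (simp_all add: algebra_simps eval_nat_numeral)
  also have "\<dots> = (real n - 2) * ((?P 2)\<^sup>2 - ?P 4)"
    unfolding sum_subtractf sum_distrib_left[symmetric] power_sum_def[symmetric]
    by (simp add: algebra_simps power2_eq_square)
  finally show ?thesis .
qed

lemma power_sum_support: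
  assumes "finite U" "0 < m"
  shows "power_sum U f m = (\<Sum>x | x \<in> U \<and> f x \<noteq> 0. f x ^ m)"
  unfolding power_sum_def using assms by (intro sum.mono_neutral_right) auto

lemma power_sum_1_sq_le:
  assumes "finite U"
  shows "(power_sum U f 1)\<^sup>2 \<le> real (card {x \<in> U. f x \<noteq> 0}) * power_sum U f 2"
  using cauchy_schwarz_card[of f "{x \<in> U. f x \<noteq> 0}"] assms by (simp add: power_sum_support)

lemma power_sum_2_sq_le:
  assumes "finite U"
  shows "(power_sum U f 2)\<^sup>2 \<le> real (card {x \<in> U. f x \<noteq> 0}) * power_sum U f 4"
  using cauchy_schwarz_card[of "\<lambda>x. (f x)\<^sup>2" "{x \<in> U. f x \<noteq> 0}"] assms by (simp add: power_sum_support)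

text \<open>Cauchy-Schwarz gives the upper side. For the lower side, \<open>n \<ge> 2\<close> makes
  the factor \<open>real n - 1\<close> at least 1, while for \<open>n \<le> 1\<close> both sides
  vanish.\<close>

lemma abs_power_sum_diff_le:
  fixes f :: "'k \<Rightarrow> real"
  assumes "finite U"
  defines "n \<equiv> card {x \<in> U. f x \<noteq> 0}"
  shows "\<bar>(power_sum U f 1)\<^sup>2 - power_sum U f 2\<bar> \<le> power_sum U f 2 * (real n - 1)"
proof -
  have le: "(power_sum U f 1)\<^sup>2 \<le> real n * power_sum U f 2"
    unfolding n_def by (rule power_sum_1_sq_le[OF assms(1)])
  have nonneg: "0 \<le> power_sum U f 2" by (simp add: power_sum_def sum_nonneg)
  consider "n = 0" | "n = 1" | "n \<ge> 2" by linarith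
  then have "power_sum U f 2 - (power_sum U f 1)\<^sup>2 \<le> power_sum U f 2 * (real n - 1)"
  proof cases
    case 1
    then have "{x \<in> U. f x \<noteq> 0} = {}" using assms by simp
    then show ?thesis using assms(1) by (simp add: power_sum_support)
  next
    case 2
    then obtain x where "{x \<in> U. f x \<noteq> 0} = {x}" unfolding n_def by (rule card_1_singletonE)
    then show ?thesis using assms(1) 2 by (simp add: power_sum_support)
  next
    case 3
    then have "power_sum U f 2 * 1 \<le> power_sum U f 2 * (real n - 1)"
      using nonneg by (intro mult_left_mono) auto
    then show ?thesis using zero_le_power2[of "power_sum U f 1"] by linarith
  qed
  with le show ?thesis by (simp add: algebra_simps abs_le_iff)
qed

section \<open>Enumerating tuples of hash values\<close>

lemma finite_tuples: "finite R \<Longrightarrow> finite {ys. length ys = k \<and> set ys \<subseteq> R}"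
  using finite_lists_length_eq[of R k] by (simp add: conj_commute)

lemma card_tuples: "finite R \<Longrightarrow> card {ys. length ys = k \<and> set ys \<subseteq> R} = card R ^ k"
  using card_lists_length_eq[of R k] by (simp add: conj_commute)

lemma sum_tuples_Suc:
  fixes g :: "'a list \<Rightarrow> real"
  shows "(\<Sum>ys | length ys = Suc k \<and> set ys \<subseteq> R. g ys) =
    (\<Sum>a\<in>R. \<Sum>ys | length ys = k \<and> set ys \<subseteq> R. g (a # ys))"
proof -
  let ?L = "\<lambda>k. {ys. length ys = k \<and> set ys \<subseteq> R}"
  have "?L (Suc k) = (\<lambda>(a, ys). a # ys) ` (R \<times> ?L k)"
    by (auto simp: length_Suc_conv image_iff)
  moreover have "inj_on (\<lambda>(a, ys). a # ys) (R \<times> ?L k)"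
    by (auto simp: inj_on_def)
  ultimately show ?thesis
    by (simp add: sum.reindex sum.cartesian_product case_prod_unfold)
qed

lemma sum_tuples_0: "(\<Sum>ys | length ys = 0 \<and> set ys \<subseteq> R. g ys) = (g [] :: real)"
proof -
  have "{ys. length ys = 0 \<and> set ys \<subseteq> R} = {[]}" by auto
  then show ?thesis by simp
qed

lemma sum_tuples_4:
  fixes g :: "'a list \<Rightarrow> real"
  shows "(\<Sum>ys | length ys = 4 \<and> set ys \<subseteq> R. g ys) =
    (\<Sum>a\<in>R. \<Sum>b\<in>R. \<Sum>c\<in>R. \<Sum>d\<in>R. g [a, b, c, d])"
  unfolding eval_nat_numeral sum_tuples_Suc BitM.simps numeral_One One_nat_def sum_tuples_0 by simp

section \<open>Marginal expectations under 4-universality\<close>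

text \<open>With fewer than four keys the uniformity condition would be vacuous. From four keys on,
  every pair or triple extends to four distinct keys and thereby inherits uniformity.\<close>

locale four_universal = prob_space M for M :: "'w measure" +
  fixes U :: "'k set" and R :: "'r set" and h :: "'k \<Rightarrow> 'w \<Rightarrow> 'r"
  assumes universal: "k_universal M 4 U R h"
    and finite_U: "finite U" and card_U: "4 \<le> card U"
    and finite_R: "finite R"
begin

text \<open>The codomain is finite, so preimages of singletons suffice, and those are intersections
  of coordinate preimages.\<close>

lemma measurable_tuple:
  assumes "set xs \<subseteq> U"
  shows "(\<lambda>\<omega>. map (\<lambda>x. h x \<omega>) xs) \<in>
    M \<rightarrow>\<^sub>M count_space {ys. length ys = length xs \<and> set ys \<subseteq> R}"
proof -
  have h: "h x \<in> M \<rightarrow>\<^sub>M count_space R" if "x \<in> U" for x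
    using universal that by (simp add: k_universal_def)
  have "(\<lambda>\<omega>. map (\<lambda>x. h x \<omega>) xs) -` {ys} \<inter> space M \<in> sets M"
    if "length ys = length xs" for ys
    using assms that
  proof (induction xs arbitrary: ys)
    case Nil
    then show ?case by simp
  next
    case (Cons x xs)
    then obtain y zs where ys: "ys = y # zs" "length zs = length xs"
      by (cases ys) auto
    have "h x -` {y} \<inter> space M \<in> sets M"
    proof (cases "y \<in> R")
      case True
      then show ?thesis using h[of x] Cons.prems by (intro measurable_sets[OF h]) auto
    next
      case False
      then have "h x -` {y} \<inter> space M = {}"
        using measurable_space[OF h[of x]] Cons.prems by auto
      then show ?thesis by simp
    qed
    moreover have "(\<lambda>\<omega>. map (\<lambda>x. h x \<omega>) xs) -` {zs} \<inter> space M \<in> sets M"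
      using Cons ys by simp
    moreover have "(\<lambda>\<omega>. map (\<lambda>x. h x \<omega>) (x # xs)) -` {ys} \<inter> space M =
      (h x -` {y} \<inter> space M) \<inter> ((\<lambda>\<omega>. map (\<lambda>x. h x \<omega>) xs) -` {zs} \<inter> space M)"
      using ys by auto
    ultimately show ?case by (metis sets.Int)
  qed
  moreover have "map (\<lambda>x. h x \<omega>) xs \<in> {ys. length ys = length xs \<and> set ys \<subseteq> R}"
    if "\<omega> \<in> space M" for \<omega>
    using measurable_space[OF h that] assms by auto
  ultimately show ?thesis
    by (subst measurable_count_space_eq2[OF finite_tuples[OF finite_R]]) auto
qed

text \<open>A function on finitely many tuples is bounded by the sum of its absolute values. Keys
  may repeat in \<open>xs\<close>, which covers products of overlapping pairs.\<close>

lemma integrable_tuple: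
  fixes g :: "'r list \<Rightarrow> real"
  assumes "set xs \<subseteq> U"
  shows "integrable M (\<lambda>\<omega>. g (map (\<lambda>x. h x \<omega>) xs))"
proof -
  let ?L = "{ys. length ys = length xs \<and> set ys \<subseteq> R}"
  note m = measurable_tuple[OF assms]
  have "norm (g (map (\<lambda>x. h x \<omega>) xs)) \<le> (\<Sum>ys\<in>?L. \<bar>g ys\<bar>)" if "\<omega> \<in> space M" for \<omega>
    using measurable_space[OF m that] finite_tuples[OF finite_R]
    by (auto intro!: member_le_sum[of _ ?L "\<lambda>ys. \<bar>g ys\<bar>"])
  moreover have "(\<lambda>\<omega>. g (map (\<lambda>x. h x \<omega>) xs)) \<in> borel_measurable M"
    by (rule measurable_compose[OF m]) simp
  ultimately show ?thesis
    by (intro integrable_const_bound[where B = "\<Sum>ys\<in>?L. \<bar>g ys\<bar>"]) auto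
qed

lemma expectation_tuple:
  fixes g :: "'r list \<Rightarrow> real"
  assumes "distinct xs" "set xs \<subseteq> U" "length xs = 4"
  shows "expectation (\<lambda>\<omega>. g (map (\<lambda>x. h x \<omega>) xs)) =
    (\<Sum>ys | length ys = 4 \<and> set ys \<subseteq> R. g ys) / real (card R) ^ 4"
proof -
  let ?L = "{ys. length ys = 4 \<and> set ys \<subseteq> R}"
  have m: "(\<lambda>\<omega>. map (\<lambda>x. h x \<omega>) xs) \<in> M \<rightarrow>\<^sub>M count_space ?L"
    using measurable_tuple[OF assms(2)] assms(3) by simp
  have "expectation (\<lambda>\<omega>. g (map (\<lambda>x. h x \<omega>) xs)) =
      integral\<^sup>L (distr M (count_space ?L) (\<lambda>\<omega>. map (\<lambda>x. h x \<omega>) xs)) g"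
    by (rule integral_distr[symmetric, OF m]) simp
  also have "distr M (count_space ?L) (\<lambda>\<omega>. map (\<lambda>x. h x \<omega>) xs) = uniform_count_measure ?L"
    using universal assms unfolding k_universal_def by blast
  also have "integral\<^sup>L (uniform_count_measure ?L) g = (\<Sum>ys\<in>?L. g ys) / real (card ?L)"
    unfolding uniform_count_measure_def
    by (subst lebesgue_integral_point_measure_finite)
      (auto simp: finite_tuples[OF finite_R] sum_divide_distrib)
  finally show ?thesis
    by (simp add: card_tuples[OF finite_R])
qed

lemma R_nonempty: "0 < card R"
proof -
  obtain \<omega> where "\<omega> \<in> space M" using not_empty by blast
  moreover obtain x where "x \<in> U" using card_U by fastforce
  ultimately have "h x \<omega> \<in> R"
    using measurable_space[OF measurable_tuple[of "[x]"], of \<omega>] by simp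
  then show ?thesis using finite_R card_gt_0_iff by blast
qed

lemma expectation_4:
  fixes g :: "'r \<Rightarrow> 'r \<Rightarrow> 'r \<Rightarrow> 'r \<Rightarrow> real"
  assumes "distinct [x, y, z, w]" "{x, y, z, w} \<subseteq> U"
  shows "expectation (\<lambda>\<omega>. g (h x \<omega>) (h y \<omega>) (h z \<omega>) (h w \<omega>)) =
    (\<Sum>a\<in>R. \<Sum>b\<in>R. \<Sum>c\<in>R. \<Sum>d\<in>R. g a b c d) / real (card R) ^ 4"
  using expectation_tuple[of "[x, y, z, w]" "\<lambda>ys. g (ys ! 0) (ys ! 1) (ys ! 2) (ys ! 3)"] assms
  by (simp add: sum_tuples_4)

lemma fresh_key:
  assumes "finite A" "card A < 4"
  obtains w where "w \<in> U" "w \<notin> A"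
proof -
  have "\<not> U \<subseteq> A"
    using card_mono[OF assms(1), of U] assms(2) card_U by linarith
  then show ?thesis using that by blast
qed

text \<open>A fresh fourth key on which \<open>g\<close> does not depend is added; summing over its
  value only contributes a factor \<open>card R\<close>, which cancels.\<close>

lemma expectation_3:
  fixes g :: "'r \<Rightarrow> 'r \<Rightarrow> 'r \<Rightarrow> real"
  assumes "distinct [x, y, z]" "{x, y, z} \<subseteq> U"
  shows "expectation (\<lambda>\<omega>. g (h x \<omega>) (h y \<omega>) (h z \<omega>)) =
    (\<Sum>a\<in>R. \<Sum>b\<in>R. \<Sum>c\<in>R. g a b c) / real (card R) ^ 3"
proof -
  have "card {x, y, z} < 4" by (simp add: card_insert_if)
  then obtain w where "w \<in> U" "w \<notin> {x, y, z}" by (rule fresh_key[rotated]) auto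
  then have "expectation (\<lambda>\<omega>. g (h x \<omega>) (h y \<omega>) (h z \<omega>)) =
      (\<Sum>a\<in>R. \<Sum>b\<in>R. \<Sum>c\<in>R. \<Sum>d\<in>R. g a b c) / real (card R) ^ 4"
    using assms by (intro expectation_4[of x y z w "\<lambda>a b c d. g a b c"]) auto
  also have "(\<Sum>a\<in>R. \<Sum>b\<in>R. \<Sum>c\<in>R. \<Sum>d\<in>R. g a b c) =
      real (card R) * (\<Sum>a\<in>R. \<Sum>b\<in>R. \<Sum>c\<in>R. g a b c)"
    by (simp add: sum_distrib_left)
  also have "\<dots> / real (card R) ^ 4 = (\<Sum>a\<in>R. \<Sum>b\<in>R. \<Sum>c\<in>R. g a b c) / real (card R) ^ 3"
    using R_nonempty by (simp add: eval_nat_numeral)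
  finally show ?thesis .
qed

lemma expectation_2:
  fixes g :: "'r \<Rightarrow> 'r \<Rightarrow> real"
  assumes "x \<noteq> y" "{x, y} \<subseteq> U"
  shows "expectation (\<lambda>\<omega>. g (h x \<omega>) (h y \<omega>)) =
    (\<Sum>a\<in>R. \<Sum>b\<in>R. g a b) / real (card R) ^ 2"
proof -
  have "card {x, y} < 4" by (simp add: card_insert_if)
  then obtain w where "w \<in> U" "w \<notin> {x, y}" by (rule fresh_key[rotated]) auto
  then have "expectation (\<lambda>\<omega>. g (h x \<omega>) (h y \<omega>)) =
      (\<Sum>a\<in>R. \<Sum>b\<in>R. \<Sum>c\<in>R. g a b) / real (card R) ^ 3"
    using assms by (intro expectation_3[of x y w "\<lambda>a b c. g a b"]) auto
  also have "(\<Sum>a\<in>R. \<Sum>b\<in>R. \<Sum>c\<in>R. g a b) = real (card R) * (\<Sum>a\<in>R. \<Sum>b\<in>R. g a b)"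
    by (simp add: sum_distrib_left)
  also have "\<dots> / real (card R) ^ 3 = (\<Sum>a\<in>R. \<Sum>b\<in>R. g a b) / real (card R) ^ 2"
    using R_nonempty by (simp add: eval_nat_numeral)
  finally show ?thesis .
qed

section \<open>Mean and variance of the off-diagonal sum\<close>

definition pair_sum :: "('k \<Rightarrow> real) \<Rightarrow> ('r \<Rightarrow> 'r \<Rightarrow> real) \<Rightarrow> 'w \<Rightarrow> real" where
  "pair_sum f K \<omega> = (\<Sum>x\<in>U. \<Sum>y\<in>U - {x}. f x * f y * K (h x \<omega>) (h y \<omega>))"

definition kernel_mean :: "('r \<Rightarrow> 'r \<Rightarrow> real) \<Rightarrow> real" where
  "kernel_mean K = (\<Sum>a\<in>R. \<Sum>b\<in>R. K a b) / real (card R) ^ 2"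

lemma integrable_4:
  fixes g :: "'r \<Rightarrow> 'r \<Rightarrow> 'r \<Rightarrow> 'r \<Rightarrow> real"
  assumes "{x, y, z, w} \<subseteq> U"
  shows "integrable M (\<lambda>\<omega>. g (h x \<omega>) (h y \<omega>) (h z \<omega>) (h w \<omega>))"
  using integrable_tuple[of "[x, y, z, w]" "\<lambda>ys. g (ys ! 0) (ys ! 1) (ys ! 2) (ys ! 3)"] assms
  by simp

lemma integrable_2:
  fixes g :: "'r \<Rightarrow> 'r \<Rightarrow> real"
  assumes "{x, y} \<subseteq> U"
  shows "integrable M (\<lambda>\<omega>. g (h x \<omega>) (h y \<omega>))"
  using integrable_4[of x x x y "\<lambda>_ _. g"] assms by simp

lemma integrable_sum_pairs:
  fixes F :: "'k \<Rightarrow> 'k \<Rightarrow> 'w \<Rightarrow> real"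
  assumes "\<And>x y. x \<in> U \<Longrightarrow> y \<in> U \<Longrightarrow> x \<noteq> y \<Longrightarrow> integrable M (F x y)"
  shows "integrable M (\<lambda>\<omega>. \<Sum>x\<in>U. \<Sum>y\<in>U - {x}. c x y * F x y \<omega>)"
  using assms by (intro Bochner_Integration.integrable_sum integrable_mult_right) auto

lemma expectation_sum_pairs:
  fixes F :: "'k \<Rightarrow> 'k \<Rightarrow> 'w \<Rightarrow> real"
  assumes "\<And>x y. x \<in> U \<Longrightarrow> y \<in> U \<Longrightarrow> x \<noteq> y \<Longrightarrow> integrable M (F x y)"
  shows "expectation (\<lambda>\<omega>. \<Sum>x\<in>U. \<Sum>y\<in>U - {x}. c x y * F x y \<omega>) =
    (\<Sum>x\<in>U. \<Sum>y\<in>U - {x}. c x y * expectation (F x y))"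
proof -
  have int: "integrable M (\<lambda>\<omega>. c x y * F x y \<omega>)" if "x \<in> U" "y \<in> U - {x}" for x y
    using that assms by (intro integrable_mult_right) auto
  have "expectation (\<lambda>\<omega>. \<Sum>x\<in>U. \<Sum>y\<in>U - {x}. c x y * F x y \<omega>) =
      (\<Sum>x\<in>U. expectation (\<lambda>\<omega>. \<Sum>y\<in>U - {x}. c x y * F x y \<omega>))"
    by (intro Bochner_Integration.integral_sum Bochner_Integration.integrable_sum int)
  also have "\<dots> = (\<Sum>x\<in>U. \<Sum>y\<in>U - {x}. expectation (\<lambda>\<omega>. c x y * F x y \<omega>))"
    by (intro sum.cong refl Bochner_Integration.integral_sum int)
  finally show ?thesis by simp
qed

lemma integrable_pair_sum: "integrable M (pair_sum f K)"
  unfolding pair_sum_def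
  by (rule integrable_sum_pairs[where F = "\<lambda>x y \<omega>. K (h x \<omega>) (h y \<omega>)"]) (simp add: integrable_2)

lemma expectation_pair_sum:
  "expectation (pair_sum f K) =
    kernel_mean K * ((power_sum U f 1)\<^sup>2 - power_sum U f 2)"
proof -
  have "expectation (pair_sum f K) =
      (\<Sum>x\<in>U. \<Sum>y\<in>U - {x}. f x * f y * expectation (\<lambda>\<omega>. K (h x \<omega>) (h y \<omega>)))"
    unfolding pair_sum_def
    by (rule expectation_sum_pairs[where F = "\<lambda>x y \<omega>. K (h x \<omega>) (h y \<omega>)"]) (simp add: integrable_2)
  also have "\<dots> = (\<Sum>x\<in>U. \<Sum>y\<in>U - {x}. f x * f y * kernel_mean K)"
    using expectation_2[where g = K]
    by (intro sum.cong refl arg_cong2[of _ _ _ _ "(*)"]) (auto simp: kernel_mean_def)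
  also have "\<dots> = (power_sum U f 1)\<^sup>2 * kernel_mean K - power_sum U f 2 * kernel_mean K"
    unfolding sum_distinct_pairs[OF finite_U]
    by (simp add: power_sum_def power2_eq_square sum_product sum_distrib_left sum_distrib_right mult_ac)
  finally show ?thesis by (simp add: algebra_simps)
qed

text \<open>Two distinct keys already give each kernel value the mean \<open>kernel_mean K\<close>,
  so the usual covariance formula applies even if the two pairs overlap.\<close>

lemma expectation_centred_product:
  fixes K :: "'r \<Rightarrow> 'r \<Rightarrow> real"
  assumes "x \<noteq> y" "z \<noteq> w" "{x, y, z, w} \<subseteq> U"
  shows "expectation (\<lambda>\<omega>. (K (h x \<omega>) (h y \<omega>) - kernel_mean K) * (K (h z \<omega>) (h w \<omega>) - kernel_mean K)) =
    expectation (\<lambda>\<omega>. K (h x \<omega>) (h y \<omega>) * K (h z \<omega>) (h w \<omega>)) - (kernel_mean K)\<^sup>2"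
proof -
  let ?m = "kernel_mean K"
  have "integrable M (\<lambda>\<omega>. K (h x \<omega>) (h y \<omega>) * K (h z \<omega>) (h w \<omega>))"
    by (rule integrable_4[of x y z w "\<lambda>a b c d. K a b * K c d", OF assms(3)])
  moreover have "integrable M (\<lambda>\<omega>. K (h x \<omega>) (h y \<omega>))" "integrable M (\<lambda>\<omega>. K (h z \<omega>) (h w \<omega>))"
    using assms by (auto intro!: integrable_2)
  moreover have "expectation (\<lambda>\<omega>. K (h x \<omega>) (h y \<omega>)) = ?m"
    "expectation (\<lambda>\<omega>. K (h z \<omega>) (h w \<omega>)) = ?m"
    using assms by (simp_all add: expectation_2 kernel_mean_def)
  moreover have "(\<lambda>\<omega>. (K (h x \<omega>) (h y \<omega>) - ?m) * (K (h z \<omega>) (h w \<omega>) - ?m)) =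
     (\<lambda>\<omega>. K (h x \<omega>) (h y \<omega>) * K (h z \<omega>) (h w \<omega>) - ?m * K (h x \<omega>) (h y \<omega>) - ?m * K (h z \<omega>) (h w \<omega>) + ?m\<^sup>2)"
    by (auto simp: algebra_simps power2_eq_square)
  ultimately show ?thesis
    by (simp add: prob_space power2_eq_square)
qed

text \<open>The square of the centred sum expands into covariances of pairs of keys. Identical pairs
  give \<open>\<alpha>\<close>; pairs with one common key are independent given its hash value, so
  squared row sums appear in \<open>\<beta>\<close>; disjoint pairs are uncorrelated. Symmetry of
  \<open>K\<close> lets the order within a pair be ignored.\<close>

lemma variance_pair_sum:
  fixes K :: "'r \<Rightarrow> 'r \<Rightarrow> real"
  assumes sym: "\<And>a b. K a b = K b a"
  defines "\<alpha> \<equiv> (\<Sum>a\<in>R. \<Sum>b\<in>R. (K a b)\<^sup>2) / real (card R) ^ 2 - (kernel_mean K)\<^sup>2"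
    and "\<beta> \<equiv> (\<Sum>a\<in>R. (\<Sum>b\<in>R. K a b)\<^sup>2) / real (card R) ^ 3 - (kernel_mean K)\<^sup>2"
  shows "variance (pair_sum f K) =
    2 * \<alpha> * ((power_sum U f 2)\<^sup>2 - power_sum U f 4) + 4 * \<beta> * triple_sum U f"
proof -
  let ?m = "kernel_mean K"
  define Z where "Z x y \<omega> = K (h x \<omega>) (h y \<omega>) - ?m" for x y \<omega>
  define C where "C x y z w = expectation (\<lambda>\<omega>. Z x y \<omega> * Z z w \<omega>)" for x y z w
  have Z_sym: "Z x y = Z y x" for x y
    by (auto simp: Z_def sym)
  have C_sym: "C x y z w = C y x z w" "C x y z w = C x y w z" for x y z w
    by (simp_all add: C_def Z_sym[of x y] Z_sym[of z w])
  have C_eq: "C x y z w = expectation (\<lambda>\<omega>. K (h x \<omega>) (h y \<omega>) * K (h z \<omega>) (h w \<omega>)) - ?m\<^sup>2"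
    if "x \<noteq> y" "z \<noteq> w" "{x, y, z, w} \<subseteq> U" for x y z w
    unfolding C_def Z_def using that by (rule expectation_centred_product)
  have same: "C x y x y = \<alpha>" if "x \<noteq> y" "{x, y} \<subseteq> U" for x y
    using C_eq[of x y x y] expectation_2[of x y "\<lambda>a b. K a b * K a b"] that
    by (simp add: \<alpha>_def power2_eq_square)
  have one: "C x y x z = \<beta>" if "distinct [x, y, z]" "{x, y, z} \<subseteq> U" for x y z
    using C_eq[of x y x z] expectation_3[of x y z "\<lambda>a b c. K a b * K a c"] that
    by (simp add: \<beta>_def power2_eq_square[of "sum _ _"] sum_product)
  \<comment> \<open>For disjoint pairs the fourfold sum factors, so the expected product equals the
    squared mean.\<close>
  have none: "C x y z w = 0" if "distinct [x, y, z, w]" "{x, y, z, w} \<subseteq> U" for x y z w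
  proof -
    have "(\<Sum>a\<in>R. \<Sum>b\<in>R. \<Sum>c\<in>R. \<Sum>d\<in>R. K a b * K c d) = (\<Sum>a\<in>R. \<Sum>b\<in>R. K a b)\<^sup>2"
      by (simp add: power2_eq_square sum_distrib_left[symmetric] sum_distrib_right[symmetric])
    then show ?thesis
      using C_eq[of x y z w] expectation_4[of x y z w "\<lambda>a b c d. K a b * K c d"] that
      by (simp add: kernel_mean_def power_divide)
  qed
  have inner: "(\<Sum>z\<in>U. \<Sum>w\<in>U - {z}. f z * f w * C x y z w) =
      2 * \<alpha> * (f x * f y) + 2 * \<beta> * ((f x + f y) * (power_sum U f 1 - f x - f y))"
    if xy: "x \<in> U" "y \<in> U" "x \<noteq> y" for x y
  proof -
    have "C x y x y = \<alpha>" "C x y y x = \<alpha>"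
      using same[of x y] C_sym[of x y] xy by auto
    moreover have "C x y x z = \<beta> \<and> C x y y z = \<beta> \<and> C x y z x = \<beta> \<and> C x y z y = \<beta>"
      if "z \<in> U - {x, y}" for z
      using one[of x y z] one[of y x z] C_sym xy that by (metis DiffE distinct_length_2_or_more
        distinct_singleton insert_iff insert_subset empty_subsetI)
    moreover have "C x y z w = 0" if "z \<in> U - {x, y}" "w \<in> U - {x, y}" "z \<noteq> w" for z w
      using none[of x y z w] that xy by auto
    ultimately show ?thesis
      using sum_pairs_meeting_pair[OF finite_U xy, of "C x y" \<alpha> \<beta> f] by (simp add: power_sum_def)
  qed
  \<comment> \<open>The mean of the whole sum is distributed over its pairs, so centring can be done
    term by term.\<close>
  have centred: "pair_sum f K \<omega> - expectation (pair_sum f K) =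
      (\<Sum>x\<in>U. \<Sum>y\<in>U - {x}. f x * f y * Z x y \<omega>)" for \<omega>
  proof -
    have "(\<Sum>x\<in>U. \<Sum>y\<in>U - {x}. f x * f y * ?m) = expectation (pair_sum f K)"
      unfolding sum_distinct_pairs[OF finite_U] expectation_pair_sum
      by (simp add: power_sum_def power2_eq_square sum_product sum_distrib_left sum_distrib_right
          right_diff_distrib mult_ac)
    then show ?thesis
      by (simp add: pair_sum_def Z_def right_diff_distrib sum_subtractf)
  qed
  have int: "integrable M (\<lambda>\<omega>. Z x y \<omega> * Z z w \<omega>)" if "{x, y, z, w} \<subseteq> U" for x y z w
    unfolding Z_def using integrable_4[OF that, of "\<lambda>a b c d. (K a b - ?m) * (K c d - ?m)"] .
  define G where "G x y \<omega> = (\<Sum>z\<in>U. \<Sum>w\<in>U - {z}. f z * f w * (Z x y \<omega> * Z z w \<omega>))" for x y \<omega>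
  have "variance (pair_sum f K) =
      expectation (\<lambda>\<omega>. \<Sum>x\<in>U. \<Sum>y\<in>U - {x}. f x * f y * G x y \<omega>)"
    unfolding centred G_def power2_eq_square sum_distrib_right
    unfolding sum_distrib_left by (simp only: mult_ac)
  also have "\<dots> = (\<Sum>x\<in>U. \<Sum>y\<in>U - {x}. f x * f y * expectation (G x y))"
    unfolding G_def using int by (intro expectation_sum_pairs integrable_sum_pairs) auto
  also have "\<dots> = (\<Sum>x\<in>U. \<Sum>y\<in>U - {x}. f x * f y * (\<Sum>z\<in>U. \<Sum>w\<in>U - {z}. f z * f w * C x y z w))"
    unfolding G_def C_def using int by (intro sum.cong refl arg_cong2[of _ _ _ _ "(*)"] expectation_sum_pairs) auto
  also have "\<dots> = (\<Sum>x\<in>U. \<Sum>y\<in>U - {x}. f x * f y *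
      (2 * \<alpha> * (f x * f y) + 2 * \<beta> * ((f x + f y) * (power_sum U f 1 - f x - f y))))"
    using inner by (intro sum.cong refl arg_cong2[of _ _ _ _ "(*)"]) auto
  also have "\<dots> = 2 * \<alpha> * ((power_sum U f 2)\<^sup>2 - power_sum U f 4) + 4 * \<beta> * triple_sum U f"
    by (rule sum_pair_weights[OF finite_U])
  finally show ?thesis .
qed

end

section \<open>Bucket sizes among the nonzero \<open>b\<close>-bit values\<close>

lemma sum_less_two_mult:
  fixes g :: "nat \<Rightarrow> 'a::comm_monoid_add"
  shows "(\<Sum>v<2 * m. g v) = (\<Sum>j<m. g j) + (\<Sum>j<m. g (m + j))"
  using sum.atLeastLessThan_concat[of 0 m "2 * m" g] sum.shift_bounds_nat_ivl[of g 0 m m]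
  by (simp add: atLeast0LessThan mult_2 add.commute)

text \<open>The values \<open>j\<close> and \<open>m + j\<close> differ only in the top bit: signed
  sums cancel over such a pair and counts double.\<close>

lemma low_high_values:
  fixes b :: nat
  defines "m \<equiv> 2 ^ (b - 1)"
  assumes "j < m"
  shows "bucket_of b r j = r * j div m" "bucket_of b r (m + j) = r * j div m"
    "sign_of b j = 1" "sign_of b (m + j) = - 1"
  using assms by (simp_all add: bucket_of_def sign_of_def m_def[symmetric])

text \<open>Adding back the missing value \<open>0\<close> completes the signed bucket sums to zero.\<close>

lemma sum_signs_in_bucket:
  assumes "0 < b"
  shows "(\<Sum>a<2 ^ b - 1. sign_of b (Suc a) * of_bool (bucket_of b r (Suc a) = t)) =
    - of_bool (t = 0)"
proof -
  define m :: nat where "m = 2 ^ (b - 1)"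
  have m: "0 < m" "(2::nat) ^ b = 2 * m" using assms by (cases b; simp add: m_def)+
  let ?g = "\<lambda>v. sign_of b v * of_bool (bucket_of b r v = t)"
  have "(\<Sum>v<2 * m. ?g v) = 0"
    unfolding sum_less_two_mult sum.distrib[symmetric]
    by (intro sum.neutral) (simp add: low_high_values[of _ b, folded m_def])
  moreover have "(\<Sum>v<Suc (2 * m - 1). ?g v) = ?g 0 + (\<Sum>a<2 * m - 1. ?g (Suc a))"
    by (rule sum.lessThan_Suc_shift)
  ultimately show ?thesis
    using m by (simp add: sign_of_def bucket_of_def)
qed

definition bucket_size :: "nat \<Rightarrow> nat \<Rightarrow> nat \<Rightarrow> nat" where
  "bucket_size b r t = card {a. a < 2 ^ b - 1 \<and> bucket_of b r (Suc a) = t}"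

text \<open>The number \<open>\<lceil>t m / r\<rceil>\<close> of \<open>j\<close> with \<open>r j < t m\<close>.\<close>

definition bucket_start :: "nat \<Rightarrow> nat \<Rightarrow> nat \<Rightarrow> nat" where
  "bucket_start m r t = (t * m + r - 1) div r"

lemma bucket_start_le_iff:
  assumes "0 < r"
  shows "bucket_start m r t \<le> j \<longleftrightarrow> t * m \<le> r * j"
proof -
  have "bucket_start m r t \<le> j \<longleftrightarrow> t * m + r - 1 < r * Suc j"
    unfolding bucket_start_def less_Suc_eq_le[symmetric]
    using assms by (simp add: div_less_iff_less_mult mult.commute)
  also have "\<dots> \<longleftrightarrow> t * m \<le> r * j" using assms by auto
  finally show ?thesis .
qed

lemma bucket_start_bounds:
  assumes "0 < r"
  shows "t * m \<le> r * bucket_start m r t" "r * bucket_start m r t < t * m + r"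
proof -
  show "t * m \<le> r * bucket_start m r t"
    using bucket_start_le_iff[OF assms, of m t "bucket_start m r t"] by simp
  have "r * bucket_start m r t \<le> t * m + r - 1"
    by (simp add: bucket_start_def)
  then show "r * bucket_start m r t < t * m + r" using assms by linarith
qed

text \<open>The floor equals \<open>t\<close> exactly when \<open>t * m \<le> r * j\<close> and
  \<open>r * j < Suc t * m\<close>, which confines \<open>j\<close> between two consecutive
  ceilings; \<open>t < r\<close> then forces \<open>j < m\<close>.\<close>

lemma low_bits_in_bucket:
  assumes "0 < r" "0 < m" "t < r"
  shows "{j. j < m \<and> r * j div m = t} = {bucket_start m r t..<bucket_start m r (Suc t)}"
proof -
  have "j < m \<and> r * j div m = t \<longleftrightarrow> t * m \<le> r * j \<and> r * j < Suc t * m" for j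
  proof
    assume "j < m \<and> r * j div m = t"
    then show "t * m \<le> r * j \<and> r * j < Suc t * m"
      using assms(2) by (metis div_times_less_eq_dividend lessI div_less_iff_less_mult)
  next
    assume *: "t * m \<le> r * j \<and> r * j < Suc t * m"
    have "Suc t * m \<le> r * m" using assms(3) by (intro mult_right_mono) auto
    then have "j < m" using * assms(1) by (metis less_le_trans nat_mult_less_cancel_disj)
    moreover have "r * j div m = t" using * by (intro div_nat_eqI) (auto simp: mult.commute)
    ultimately show "j < m \<and> r * j div m = t" ..
  qed
  moreover have "j < bucket_start m r (Suc t) \<longleftrightarrow> r * j < Suc t * m" for j
    using bucket_start_le_iff[OF assms(1), of m "Suc t" j] by (simp only: not_le[symmetric])
  ultimately show ?thesis
    using bucket_start_le_iff[OF assms(1), of m t] by auto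
qed

lemma card_eq_sum_of_bool:
  fixes n :: nat
  shows "int (card {a. a < n \<and> P a}) = (\<Sum>a<n. of_bool (P a))"
proof -
  have "(\<Sum>a<n. of_bool (P a)) = (\<Sum>a | a < n \<and> P a. 1 :: int)"
    by (intro sum.mono_neutral_cong_right) auto
  then show ?thesis by simp
qed

text \<open>Each low-bit pattern occurs with both top bits, hence the factor 2; the excluded value
  \<open>0\<close> would lie in bucket \<open>0\<close>.\<close>

lemma bucket_size_eq:
  fixes b :: nat
  assumes "0 < b" "t < r"
  defines "m \<equiv> 2 ^ (b - 1)"
  shows "int (bucket_size b r t) =
    2 * (int (bucket_start m r (Suc t)) - int (bucket_start m r t)) - of_bool (t = 0)"
proof -
  have m: "0 < m" "(2::nat) ^ b = 2 * m" using assms by (cases b; simp add: m_def)+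
  let ?g = "\<lambda>v. of_bool (bucket_of b r v = t) :: int"
  have le: "bucket_start m r t \<le> bucket_start m r (Suc t)"
    by (simp add: bucket_start_def div_le_mono)
  have "(\<Sum>j<m. of_bool (r * j div m = t)) = int (card {bucket_start m r t..<bucket_start m r (Suc t)})"
    using low_bits_in_bucket[of r m t] assms m by (simp add: card_eq_sum_of_bool[symmetric])
  moreover have "(\<Sum>v<2 * m. ?g v) = 2 * (\<Sum>j<m. of_bool (r * j div m = t))"
    unfolding sum_less_two_mult sum.distrib[symmetric] sum_distrib_left
    by (intro sum.cong refl) (simp add: low_high_values[of _ b, folded m_def])
  ultimately have "(\<Sum>v<2 * m. ?g v) = 2 * (int (bucket_start m r (Suc t)) - int (bucket_start m r t))"
    using le by simp
  moreover have "(\<Sum>v<Suc (2 * m - 1). ?g v) = ?g 0 + (\<Sum>a<2 * m - 1. ?g (Suc a))"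
    by (rule sum.lessThan_Suc_shift)
  moreover have "?g 0 = of_bool (t = 0)"
    by (auto simp: bucket_of_def)
  ultimately show ?thesis
    using m by (simp add: bucket_size_def card_eq_sum_of_bool)
qed

text \<open>
  Each bucket receives \<open>c = \<lfloor>m/r\<rfloor>\<close> or \<open>c + 1\<close> of the \<open>m\<close> low-bit patterns,
  so \<open>(n\<^sub>t - c) (n\<^sub>t - c - 1) = 0\<close> and the sum of squares is determined by the sum.
\<close>

lemma sum_bucket_start_diff_squares:
  fixes m r :: nat
  assumes "0 < r"
  defines "c \<equiv> int (m div r)"
  shows "(\<Sum>t<r. (int (bucket_start m r (Suc t)) - int (bucket_start m r t))\<^sup>2) =
    (2 * c + 1) * int m - int r * c * (c + 1)"
proof -
  define d where "d t = int (bucket_start m r (Suc t)) - int (bucket_start m r t)" for t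
  have sq: "(d t)\<^sup>2 = (2 * c + 1) * d t - c * (c + 1)" for t
  proof -
    define e where "e = int (m mod r)"
    have e: "int m = int r * c + e" "0 \<le> e" "e < int r"
      using assms by (simp_all add: c_def e_def flip: of_nat_mult of_nat_add)
    have "int (t * m) \<le> int (r * bucket_start m r t)" "int (r * bucket_start m r t) < int (t * m + r)"
      "int (Suc t * m) \<le> int (r * bucket_start m r (Suc t))"
      "int (r * bucket_start m r (Suc t)) < int (Suc t * m + r)"
      using bucket_start_bounds[OF assms(1)] by (auto simp only: of_nat_le_iff of_nat_less_iff)
    \<comment> \<open>Rounding up moves each boundary by less than one, so \<open>r * d t\<close>
      differs from \<open>m\<close> by less than \<open>r\<close>; as \<open>m\<close> is at least
      \<open>r * c\<close> and below \<open>r * (c + 1)\<close>, only two integers remain for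
      \<open>d t\<close>.\<close>
    then have "int r * d t > int m - int r" "int r * d t < int m + int r"
      by (simp_all add: d_def algebra_simps)
    then have "int r * d t > int r * (c - 1)" "int r * d t < int r * (c + 2)"
      using e by (auto simp: algebra_simps)
    then have "c - 1 < d t" "d t < c + 2"
      using assms(1) by simp_all
    then have "d t = c \<or> d t = c + 1" by linarith
    then show ?thesis by (auto simp: algebra_simps power2_eq_square)
  qed
  have "bucket_start m r r = m"
  proof -
    have "r * m + r - 1 = (r - 1) + r * m" using assms(1) by simp
    then show ?thesis using assms(1) by (simp only: bucket_start_def div_mult_self2) simp
  qed
  moreover have "bucket_start m r 0 = 0"
    using assms(1) by (simp add: bucket_start_def)
  ultimately have "sum d {..<r} = int m"
    unfolding d_def by (subst sum_lessThan_telescope) simp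
  then show ?thesis
    unfolding d_def[symmetric] sq sum_subtractf sum_distrib_left[symmetric] by simp
qed

text \<open>With \<open>m = r * c + e\<close>, the sum of squares is known exactly up to the size of
  bucket \<open>0\<close>, so a lower bound on \<open>d 0\<close> suffices. The remaining slack is a
  perfect square both when \<open>r\<close> divides \<open>m\<close> and when it does not.\<close>

lemma sum_bucket_size_squares_le:
  assumes "0 < b" "0 < r"
  shows "int r * (\<Sum>t<r. (int (bucket_size b r t))\<^sup>2) \<le> (2 ^ b - 1)\<^sup>2 + int r * (int r - 1)"
proof -
  define m :: nat where "m = 2 ^ (b - 1)"
  have b: "(2::int) ^ b = 2 * int m" using assms(1) by (cases b) (auto simp: m_def)
  define c where "c = int (m div r)"
  define e where "e = int (m mod r)"
  have e: "int m = int r * c + e" "0 \<le> e" "e < int r"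
    using assms by (simp_all add: c_def e_def flip: of_nat_mult of_nat_add)
  define d where "d t = int (bucket_start m r (Suc t)) - int (bucket_start m r t)" for t
  have "bucket_start m r 0 = 0" using assms(2) by (simp add: bucket_start_def)
  \<comment> \<open>Bucket \<open>0\<close> starts at \<open>0\<close>, so \<open>d 0\<close> is the
    ceiling of \<open>m / r\<close>.\<close>
  then have d0: "int r * d 0 \<ge> int m"
    using bucket_start_bounds(1)[OF assms(2), where t = 1 and m = m] by (simp add: d_def flip: of_nat_mult)
  \<comment> \<open>Only bucket \<open>0\<close> loses a value, and
    \<open>(2 * d 0 - 1)\<^sup>2 = 4 * (d 0)\<^sup>2 - (4 * d 0 - 1)\<close>.\<close>
  have "(int (bucket_size b r t))\<^sup>2 = 4 * (d t)\<^sup>2 - of_bool (t = 0) * (4 * d 0 - 1)" if "t < r" for t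
  proof -
    have eq: "int (bucket_size b r t) = 2 * d t - of_bool (t = 0)"
      using bucket_size_eq[OF assms(1) that, folded m_def] by (simp add: d_def)
    show ?thesis unfolding eq by (cases "t = 0") (simp_all add: power2_eq_square algebra_simps)
  qed
  then have "(\<Sum>t<r. (int (bucket_size b r t))\<^sup>2) =
      (\<Sum>t<r. 4 * (d t)\<^sup>2 - of_bool (t = 0) * (4 * d 0 - 1))"
    by (intro sum.cong refl) auto
  also have "\<dots> = 4 * ((2 * c + 1) * int m - int r * c * (c + 1)) - (4 * d 0 - 1)"
  proof -
    have "(\<Sum>t<r. of_bool (t = 0) :: int) = 1"
      using assms(2) by (simp add: card_eq_sum_of_bool[symmetric] Collect_conv_if conj_commute)
    then show ?thesis
      unfolding sum_subtractf sum_distrib_left[symmetric] sum_distrib_right[symmetric]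
      by (simp add: d_def sum_bucket_start_diff_squares[OF assms(2)] c_def)
  qed
  finally have sum_eq: "(\<Sum>t<r. (int (bucket_size b r t))\<^sup>2) =
      4 * ((2 * c + 1) * int m - int r * c * (c + 1)) - (4 * d 0 - 1)" .
  have "int r * (\<Sum>t<r. (int (bucket_size b r t))\<^sup>2) =
      4 * ((int m)\<^sup>2 + e * (int r - e)) - 4 * (int r * d 0) + int r"
    unfolding sum_eq by (simp add: e(1) algebra_simps power2_eq_square)
  also have "\<dots> \<le> (2 * int m - 1)\<^sup>2 + int r * (int r - 1)"
  proof (cases "e = 0")
    case True
    have "0 \<le> (int r - 1)\<^sup>2" by simp
    then show ?thesis using True d0 by (simp add: power2_eq_square algebra_simps)
  next
    case False
    \<comment> \<open>A nonzero remainder makes \<open>d 0\<close> at least \<open>c + 1\<close>;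
      this stronger bound on \<open>r * d 0\<close> leaves \<open>(r + 1 - 2 * e)\<^sup>2\<close> as
      slack.\<close>
    then have "int r * c < int r * d 0" using d0 e by linarith
    then have "c + 1 \<le> d 0" using assms(2) by simp
    then have "int r * (c + 1) \<le> int r * d 0" by (intro mult_left_mono) auto
    then have "int m - e + int r \<le> int r * d 0" using e by (simp add: algebra_simps)
    moreover have "0 \<le> (int r + 1 - 2 * e)\<^sup>2" by simp
    ultimately show ?thesis by (simp add: power2_eq_square algebra_simps)
  qed
  finally show ?thesis by (simp add: b)
qed

text \<open>The size is \<open>2 * s - 1\<close> with \<open>s\<close> the ceiling of
  \<open>m / r\<close>. In the variance it governs the covariance of pairs sharing one key: the
  lower bound settles its sign, the upper bound limits its size.\<close>

lemma bucket_size_0_bounds: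
  assumes "0 < b" "0 < r"
  shows "1 \<le> bucket_size b r 0" "r * bucket_size b r 0 \<le> 2 ^ b + r"
proof -
  define m :: nat where "m = 2 ^ (b - 1)"
  have b: "0 < m" "(2::nat) ^ b = 2 * m" using assms by (cases b; simp add: m_def)+
  define s where "s = bucket_start m r 1"
  have s: "m \<le> r * s" "r * s < m + r"
    using bucket_start_bounds[OF assms(2), where t = 1 and m = m] by (simp_all add: s_def)
  then have "0 < s" using b(1) by (cases s) auto
  have "bucket_start m r 0 = 0" using assms(2) by (simp add: bucket_start_def)
  then have eq: "int (bucket_size b r 0) = 2 * int s - 1"
    using bucket_size_eq[OF assms, folded m_def] by (simp add: s_def)
  then show "1 \<le> bucket_size b r 0" using \<open>0 < s\<close> by linarith
  from eq have "bucket_size b r 0 + 1 = 2 * s" by linarith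
  then have "r * bucket_size b r 0 + r = 2 * (r * s)"
    by (metis add.commute mult.left_commute mult_Suc_right plus_1_eq_Suc)
  then show "r * bucket_size b r 0 \<le> 2 ^ b + r" using s b by linarith
qed

section \<open>The sketch as a kernel, and the kernel's sums\<close>

definition sign_kernel :: "nat \<Rightarrow> nat \<Rightarrow> nat \<Rightarrow> nat \<Rightarrow> real" where
  "sign_kernel b r v w = real_of_int (sign_of b (v + 1) * sign_of b (w + 1)) *
     of_bool (bucket_of b r (v + 1) = bucket_of b r (w + 1))"

lemma sign_of_sq:
  assumes "0 < b" "v < 2 ^ b"
  shows "sign_of b v * sign_of b v = 1"
  using sign_of_cases[OF assms] by auto

text \<open>After factoring out the sign of \<open>v\<close>, the signed size of its bucket remains,
  which vanishes except for bucket \<open>0\<close>.\<close>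

lemma sign_kernel_row_sum:
  assumes "0 < b"
  shows "(\<Sum>w<2 ^ b - 1. sign_kernel b r v w) =
    - real_of_int (sign_of b (v + 1)) * of_bool (bucket_of b r (v + 1) = 0)"
proof -
  have "(\<Sum>w<2 ^ b - 1. sign_kernel b r v w) = real_of_int (sign_of b (v + 1) *
      (\<Sum>w<2 ^ b - 1. sign_of b (Suc w) * of_bool (bucket_of b r (Suc w) = bucket_of b r (v + 1))))"
    unfolding sign_kernel_def of_int_mult of_int_sum sum_distrib_left
    by (intro sum.cong refl) (auto simp: of_bool_def)
  then show ?thesis
    unfolding sum_signs_in_bucket[OF assms] by (simp add: of_bool_def)
qed

text \<open>Summing the rows uses the signed size of bucket \<open>0\<close> a second time, and
  \<open>(- 1) * (- 1) = 1\<close>.\<close>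

lemma sum_sign_kernel:
  assumes "0 < b"
  shows "(\<Sum>v<2 ^ b - 1. \<Sum>w<2 ^ b - 1. sign_kernel b r v w) = 1"
proof -
  have "(\<Sum>v<2 ^ b - 1. \<Sum>w<2 ^ b - 1. sign_kernel b r v w) = - real_of_int
      (\<Sum>v<2 ^ b - 1. sign_of b (Suc v) * of_bool (bucket_of b r (Suc v) = 0))"
    unfolding sign_kernel_row_sum[OF assms] of_int_sum sum_negf[symmetric]
    by (intro sum.cong refl) (auto simp: of_bool_def)
  then show ?thesis unfolding sum_signs_in_bucket[OF assms] by simp
qed

lemma sum_sign_kernel_row_sq:
  assumes "0 < b"
  shows "(\<Sum>v<2 ^ b - 1. (\<Sum>w<2 ^ b - 1. sign_kernel b r v w)\<^sup>2) = real (bucket_size b r 0)"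
proof -
  have "(\<Sum>v<2 ^ b - 1. (\<Sum>w<2 ^ b - 1. sign_kernel b r v w)\<^sup>2) =
      real_of_int (\<Sum>v<2 ^ b - 1. of_bool (bucket_of b r (Suc v) = 0))"
    unfolding sign_kernel_row_sum[OF assms] of_int_sum
  proof (intro sum.cong refl)
    fix v :: nat assume "v \<in> {..<2 ^ b - 1}"
    then have "sign_of b (v + 1) * sign_of b (v + 1) = 1"
      using assms by (intro sign_of_sq) auto
    then show "(- real_of_int (sign_of b (v + 1)) * of_bool (bucket_of b r (v + 1) = 0))\<^sup>2 =
        real_of_int (of_bool (bucket_of b r (Suc v) = 0))"
      by (simp add: power2_eq_square flip: of_int_mult)
  qed
  then show ?thesis
    by (simp only: card_eq_sum_of_bool[symmetric] bucket_size_def of_int_of_nat_eq)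
qed

text \<open>Squaring removes the signs and leaves the collision indicator. Splitting it by the
  common bucket \<open>t\<close> separates \<open>v\<close> from \<open>w\<close>, so each bucket
  contributes its squared size.\<close>

lemma sum_sign_kernel_sq:
  assumes "0 < b" "0 < r"
  shows "(\<Sum>v<2 ^ b - 1. \<Sum>w<2 ^ b - 1. (sign_kernel b r v w)\<^sup>2) =
    (\<Sum>t<r. (real (bucket_size b r t))\<^sup>2)"
proof -
  let ?i = "\<lambda>v. bucket_of b r (Suc v)"
  have "(sign_kernel b r v w)\<^sup>2 = (\<Sum>t<r. of_bool (?i v = t) * of_bool (?i w = t))"
    if "v < 2 ^ b - 1" "w < 2 ^ b - 1" for v w
  proof -
    have "sign_of b (Suc v) * sign_of b (Suc v) = 1" "sign_of b (Suc w) * sign_of b (Suc w) = 1"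
      using that assms by (auto intro!: sign_of_sq)
    then have "real_of_int ((sign_of b (Suc v) * sign_of b (Suc v)) * (sign_of b (Suc w) * sign_of b (Suc w))) = 1"
      by simp
    then have "(sign_kernel b r v w)\<^sup>2 = of_bool (?i v = ?i w)"
      by (auto simp: sign_kernel_def power2_eq_square mult_ac of_bool_def)
    also have "\<dots> = (\<Sum>t<r. if ?i v = t then of_bool (?i w = t) else 0)"
      using bucket_of_less[OF assms(2)] by (auto simp: sum.delta' of_bool_def)
    also have "\<dots> = (\<Sum>t<r. of_bool (?i v = t) * of_bool (?i w = t))"
      by (intro sum.cong refl) auto
    finally show ?thesis .
  qed
  then have "(\<Sum>v<2 ^ b - 1. \<Sum>w<2 ^ b - 1. (sign_kernel b r v w)\<^sup>2) =
      (\<Sum>v<2 ^ b - 1. \<Sum>w<2 ^ b - 1. \<Sum>t<r. of_bool (?i v = t) * of_bool (?i w = t))"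
    by (intro sum.cong refl) auto
  also have "\<dots> = (\<Sum>t<r. \<Sum>v<2 ^ b - 1. \<Sum>w<2 ^ b - 1. of_bool (?i v = t) * of_bool (?i w = t))"
    unfolding sum.swap[of _ "{..<r}"] ..
  also have "\<dots> = (\<Sum>t<r. (real (bucket_size b r t))\<^sup>2)"
  proof (intro sum.cong refl)
    fix t
    have "real (bucket_size b r t) = real_of_int (\<Sum>v<2 ^ b - 1. of_bool (?i v = t))"
      by (simp only: card_eq_sum_of_bool[symmetric] bucket_size_def of_int_of_nat_eq)
    then show "(\<Sum>v<2 ^ b - 1. \<Sum>w<2 ^ b - 1. of_bool (?i v = t) * of_bool (?i w = t)) =
        (real (bucket_size b r t))\<^sup>2"
      by (simp only: power2_eq_square sum_product of_int_sum of_int_of_bool)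
  qed
  finally show ?thesis .
qed

text \<open>The square of a counter is a double sum, and for fixed \<open>x\<close>,
  \<open>y\<close> at most one \<open>t\<close> survives. The range assumption ensures that this
  \<open>t = i x\<close> is among the counters.\<close>

lemma sketch_estimate_eq:
  assumes "\<And>x. x < u \<Longrightarrow> i x < r"
  shows "sketch_estimate u r s i f = (\<Sum>x<u. \<Sum>y<u. f x * f y * (s x * s y * of_bool (i x = i y)))"
proof -
  have "sketch_estimate u r s i f = (\<Sum>t<r. \<Sum>x<u. \<Sum>y<u.
      s x * f x * of_bool (i x = t) * (s y * f y * of_bool (i y = t)))"
    by (simp only: sketch_estimate_def counter_def power2_eq_square sum_product)
  also have "\<dots> = (\<Sum>x<u. \<Sum>y<u. \<Sum>t<r.
      s x * f x * of_bool (i x = t) * (s y * f y * of_bool (i y = t)))"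
    unfolding sum.swap[of _ _ "{..<r}"] ..
  also have "\<dots> = (\<Sum>x<u. \<Sum>y<u. f x * f y * (s x * s y * of_bool (i x = i y)))"
  proof (intro sum.cong refl)
    fix x y assume "x \<in> {..<u}"
    then have "i x < r" using assms by simp
    have "(\<Sum>t<r. s x * f x * of_bool (i x = t) * (s y * f y * of_bool (i y = t))) =
        (\<Sum>t<r. if i x = t then f x * f y * (s x * s y * of_bool (i y = t)) else 0)"
      by (intro sum.cong refl) auto
    also have "\<dots> = f x * f y * (s x * s y * of_bool (i x = i y))"
      using \<open>i x < r\<close> by (auto simp: sum.delta')
    finally show "(\<Sum>t<r. s x * f x * of_bool (i x = t) * (s y * f y * of_bool (i y = t))) =
      f x * f y * (s x * s y * of_bool (i x = i y))" .
  qed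
  finally show ?thesis .
qed

section \<open>The real-number inequality behind the variance bound\<close>

lemma power_sum_4_le:
  assumes "finite U"
  shows "power_sum U f 4 \<le> (power_sum U f 2)\<^sup>2"
proof -
  have "0 \<le> (\<Sum>x\<in>U. \<Sum>y\<in>U - {x}. (f x)\<^sup>2 * (f y)\<^sup>2)"
    by (intro sum_nonneg) auto
  also have "\<dots> = (power_sum U f 2)\<^sup>2 - power_sum U f 4"
    unfolding sum_distinct_pairs[OF assms]
    by (simp add: power_sum_def power2_eq_square[of "sum _ _"] sum_product flip: power_add)
  finally show ?thesis by simp
qed

text \<open>
  The factor \<open>1 - 1/n\<close> gained from \<open>F\<^sub>2\<^sup>2 \<le> n F\<^sub>4\<close> pays for
  the triple terms, whose relative weight is \<open>w\<close>.
\<close>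

lemma sketch_variance_bound:
  fixes r q p Q N n \<alpha> \<beta> F\<^sub>2 F\<^sub>4 T :: real
  assumes r: "1 < r" "4 * r \<le> q" and p: "p = q - 1"
    and n: "1 \<le> n" "2 * n \<le> q" "n = 1 \<or> 2 \<le> n"
    and Q: "r * Q \<le> p\<^sup>2 + r * (r - 1)"
    and N: "1 \<le> N" "r * N \<le> q + r"
    and \<alpha>: "\<alpha> = Q / p ^ 2 - (1 / p\<^sup>2)\<^sup>2" and \<beta>: "\<beta> = N / p ^ 3 - (1 / p\<^sup>2)\<^sup>2"
    and F: "0 < F\<^sub>2" "F\<^sub>4 \<le> F\<^sub>2\<^sup>2" "F\<^sub>2\<^sup>2 \<le> n * F\<^sub>4" and T: "T \<le> (n - 2) * (F\<^sub>2\<^sup>2 - F\<^sub>4)"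
  shows "2 * \<alpha> * (F\<^sub>2\<^sup>2 - F\<^sub>4) + 4 * \<beta> * T < 2 * (1 + (r / q)\<^sup>2) * F\<^sub>2\<^sup>2 / r"
proof -
  define D where "D = F\<^sub>2\<^sup>2 - F\<^sub>4"
  define G where "G = 1 + (r / q)\<^sup>2"
  define w where "w = 2 * (n - 2) * (q + r) / p ^ 3"
  have pos: "1 < p" "0 < q" "0 < r" using r p by auto
  have D: "0 \<le> D" "n * D \<le> (n - 1) * F\<^sub>2\<^sup>2"
    using F by (auto simp: D_def algebra_simps)
  \<comment> \<open>\<open>\<beta>\<close> must be nonnegative for the upper bound on
    \<open>T\<close> to be usable.\<close>
  have "(1 / p\<^sup>2)\<^sup>2 = 1 / p ^ 4" by (simp add: power_divide)
  also have "\<dots> \<le> 1 / p ^ 3" using pos by (intro divide_left_mono power_increasing) auto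
  also have "\<dots> \<le> N / p ^ 3" using pos N by (intro divide_right_mono) auto
  finally have \<beta>0: "0 \<le> \<beta>" by (simp add: \<beta>)
  have G1: "1 \<le> G" by (simp add: G_def)
  have "4 * \<beta> * T \<le> 4 * \<beta> * ((n - 2) * D)"
    using T \<beta>0 by (intro mult_left_mono) (auto simp: D_def)
  then have V: "2 * \<alpha> * D + 4 * \<beta> * T \<le> 2 * D * (\<alpha> + 2 * (n - 2) * \<beta>)"
    by (simp add: algebra_simps)
  have "2 * D * (\<alpha> + 2 * (n - 2) * \<beta>) < 2 * G * F\<^sub>2\<^sup>2 / r"
  proof (cases "n = 1")
    case True
    \<comment> \<open>With a single nonzero key the left side vanishes, and strictness comes from
      \<open>0 < F\<^sub>2\<close>.\<close>
    then have "D = 0" using D by simp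
    then show ?thesis using pos G1 F by simp
  next
    case False
    then have n2: "2 \<le> n" using n by simp
    have "r * \<alpha> \<le> r * (Q / p ^ 2)" using pos by (intro mult_left_mono) (auto simp: \<alpha>)
    also have "\<dots> \<le> (p\<^sup>2 + r * (r - 1)) / p\<^sup>2"
      using Q by (simp add: divide_right_mono)
    also have "\<dots> = 1 + r * (r - 1) / p\<^sup>2" using pos by (simp add: add_divide_distrib)
    also have "\<dots> \<le> 1 + r\<^sup>2 / q\<^sup>2"
    proof -
      \<comment> \<open>The right side is \<open>r * p\<^sup>2 - (r - 1) * q\<^sup>2\<close>
        expanded with \<open>p = q - 1\<close>, arranged so that \<open>4 * r \<le> q\<close> shows
        it nonnegative.\<close>
      have "0 \<le> q * (q - 4 * r) + 2 * q * r + r" using r pos by (intro add_nonneg_nonneg mult_nonneg_nonneg) auto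
      then have "(r - 1) * q\<^sup>2 \<le> r * p\<^sup>2" by (simp add: p power2_eq_square algebra_simps)
      then have "r * ((r - 1) * q\<^sup>2) \<le> r * (r * p\<^sup>2)" using pos by (intro mult_left_mono) auto
      then show ?thesis using pos by (simp add: field_simps power2_eq_square)
    qed
    finally have r\<alpha>: "r * \<alpha> \<le> G" by (simp add: G_def power_divide)
    have "r * \<beta> \<le> r * (N / p ^ 3)" using pos by (intro mult_left_mono) (auto simp: \<beta>)
    also have "\<dots> \<le> (q + r) / p ^ 3" using N pos by (simp add: divide_right_mono)
    finally have "2 * (n - 2) * (r * \<beta>) \<le> 2 * (n - 2) * ((q + r) / p ^ 3)"
      using n2 by (intro mult_left_mono) auto
    then have r\<beta>: "2 * (n - 2) * (r * \<beta>) \<le> w" by (simp add: w_def)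
    \<comment> \<open>\<open>n \<le> q / 2\<close> limits \<open>(n - 1) * (n - 2)\<close>, and
      \<open>r \<le> q / 4\<close> gives \<open>q + r \<le> 5 / 4 * q\<close>. The resulting
      constant \<open>5 / 8\<close> is below 1, and \<open>q * (q - 2) * (q - 4)\<close> does not
      exceed \<open>p ^ 3\<close>.\<close>
    have w: "(n - 1) * w < 1"
    proof -
      have "(n - 1) * (n - 2) \<le> ((q - 2) / 2) * ((q - 4) / 2)"
        using n n2 by (intro mult_mono) auto
      then have "(n - 1) * (n - 2) * (2 * (q + r)) \<le> ((q - 2) / 2) * ((q - 4) / 2) * (2 * (5 / 4 * q))"
        using r pos n n2 by (intro mult_mono) auto
      also have "\<dots> = 5 / 8 * (q * (q - 2) * (q - 4))" by simp
      also have "\<dots> < p ^ 3"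
      proof -
        have "q * (q - 2) * (q - 4) \<le> p\<^sup>2 * p"
        proof (rule mult_mono)
          have "p\<^sup>2 = q * (q - 2) + 1" by (simp add: p power2_eq_square algebra_simps)
          then show "q * (q - 2) \<le> p\<^sup>2" by simp
        qed (use r n n2 in \<open>auto simp: p\<close>)
        moreover have "0 < p ^ 3" using pos by simp
        ultimately show ?thesis by (simp add: eval_nat_numeral)
      qed
      finally show ?thesis using pos by (simp add: w_def field_simps)
    qed
    have w0: "0 \<le> w" using n2 pos by (simp add: w_def)
    \<comment> \<open>Multiplying by \<open>n\<close> turns the gain into the factor
      \<open>(n - 1) * (G + w)\<close>, which is below \<open>n * G\<close> because
      \<open>(n - 1) * w < 1\<close> and \<open>1 \<le> G\<close>.\<close>
    have "n * (r * (2 * D * (\<alpha> + 2 * (n - 2) * \<beta>))) = 2 * (n * D) * (r * \<alpha> + 2 * (n - 2) * (r * \<beta>))"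
      by (simp add: algebra_simps)
    also have "\<dots> \<le> 2 * (n * D) * (G + w)"
      using r\<alpha> r\<beta> D(1) n2 by (intro mult_left_mono add_mono) auto
    also have "\<dots> \<le> 2 * ((n - 1) * F\<^sub>2\<^sup>2) * (G + w)"
      using D(2) G1 w0 by (intro mult_right_mono mult_left_mono) auto
    also have "\<dots> = 2 * F\<^sub>2\<^sup>2 * (n * G - G + (n - 1) * w)" by (simp add: algebra_simps)
    also have "\<dots> < 2 * F\<^sub>2\<^sup>2 * (n * G)"
      using w G1 F(1) by (intro mult_strict_left_mono) auto
    finally have "n * (r * (2 * D * (\<alpha> + 2 * (n - 2) * \<beta>))) < n * (2 * G * F\<^sub>2\<^sup>2)"
      by (simp add: mult_ac)
    then have "r * (2 * D * (\<alpha> + 2 * (n - 2) * \<beta>)) < 2 * G * F\<^sub>2\<^sup>2"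
      using n2 by simp
    then show ?thesis using pos by (simp add: field_simps)
  qed
  with V show ?thesis by (simp add: D_def G_def)
qed

section \<open>Moments of the Mersenne-prime sketch\<close>

text \<open>For \<open>f = 0\<close> both the variance and its bound are zero, so the strict
  inequality can hold only when some frequency is nonzero.\<close>

theorem theorem8:
  fixes M :: "'w measure" and h :: "nat \<Rightarrow> 'w \<Rightarrow> nat"
    and u r b p :: nat and f :: "nat \<Rightarrow> int"
  assumes "prob_space M"
    and "\<exists>k. u = 2 ^ k"
    and "1 < r" and "real r \<le> real u / 2"
    and "p = 2 ^ b - 1" and "prime p" and "u < p"
    and "k_universal M 4 {..<u} {..<p} h"
  shows "prob_space.expectation M (mersenne_estimate u r b h f) =
           freq_moment u f 2 + ((freq_moment u f 1)\<^sup>2 - freq_moment u f 2) / (real p)\<^sup>2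
       \<and> \<bar>prob_space.expectation M (mersenne_estimate u r b h f) - freq_moment u f 2\<bar>
           \<le> freq_moment u f 2 * (real (num_nonzero u f) - 1) / (real p)\<^sup>2
       \<and> ((\<exists>x<u. f x \<noteq> 0) \<longrightarrow>
         prob_space.variance M (mersenne_estimate u r b h f)
           < 2 * (1 + (real r / 2 ^ b)\<^sup>2) * (freq_moment u f 2)\<^sup>2 / real r)"
proof -
  have b: "0 < b" using assms(5,7) by (cases b) auto
  have r0: "0 < r" using assms(3) by simp
  \<comment> \<open>From \<open>1 < r\<close> and \<open>r \<le> u / 2\<close> follows
    \<open>u \<ge> 4\<close>, so there are enough keys.\<close>
  interpret four_universal M "{..<u}" "{..<p}" h
    using assms by (intro four_universal.intro four_universal_axioms.intro) auto
  define g where "g x = real_of_int (f x)" for x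
  let ?P = "power_sum {..<u} g"
  define K where "K = sign_kernel b r"
  have freq: "freq_moment u f m = ?P m" for m
    by (simp add: freq_moment_def power_sum_def g_def)
  have num: "num_nonzero u f = card {x \<in> {..<u}. g x \<noteq> 0}"
    by (simp add: num_nonzero_def g_def)
  \<comment> \<open>On \<open>space M\<close> the hash values are known to lie below
    \<open>p\<close>; there squared signs are \<open>1\<close>, and the diagonal gives the second
    moment.\<close>
  have estimate: "mersenne_estimate u r b h f \<omega> = ?P 2 + pair_sum g K \<omega>" if \<omega>: "\<omega> \<in> space M" for \<omega>
  proof -
    have K_diag: "K (h x \<omega>) (h x \<omega>) = 1" if "x < u" for x
    proof -
      have "h x \<omega> < p"
        using measurable_space[OF measurable_tuple[of "[x]"] \<omega>] that by simp
      then have "sign_of b (h x \<omega> + 1) * sign_of b (h x \<omega> + 1) = 1"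
        using b assms(5) by (intro sign_of_sq) auto
      then show ?thesis by (simp add: K_def sign_kernel_def)
    qed
    have "mersenne_estimate u r b h f \<omega> = (\<Sum>x<u. \<Sum>y<u. g x * g y * K (h x \<omega>) (h y \<omega>))"
      unfolding mersenne_estimate_def
      by (subst sketch_estimate_eq) (simp_all add: bucket_of_less r0 K_def sign_kernel_def g_def)
    also have "\<dots> = (\<Sum>x<u. g x * g x * K (h x \<omega>) (h x \<omega>)) + pair_sum g K \<omega>"
      unfolding pair_sum_def by (subst sum_distinct_pairs) auto
    also have "(\<Sum>x<u. g x * g x * K (h x \<omega>) (h x \<omega>)) = ?P 2"
      by (simp add: power_sum_def power2_eq_square K_diag)
    finally show ?thesis .
  qed
  have mean: "kernel_mean K = 1 / (real p)\<^sup>2"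
    using sum_sign_kernel[OF b, of r]
    unfolding kernel_mean_def K_def assms(5)[symmetric] by simp
  have "expectation (mersenne_estimate u r b h f) = expectation (\<lambda>\<omega>. ?P 2 + pair_sum g K \<omega>)"
    by (intro Bochner_Integration.integral_cong refl estimate)
  also have "\<dots> = ?P 2 + expectation (pair_sum g K)"
    using integrable_pair_sum by (simp add: prob_space)
  finally have E: "expectation (mersenne_estimate u r b h f) = ?P 2 + expectation (pair_sum g K)" .
  have EY: "expectation (pair_sum g K) = ((?P 1)\<^sup>2 - ?P 2) / (real p)\<^sup>2"
    unfolding expectation_pair_sum mean by simp
  have bias: "\<bar>expectation (mersenne_estimate u r b h f) - ?P 2\<bar> \<le>
      ?P 2 * (real (num_nonzero u f) - 1) / (real p)\<^sup>2"
    using abs_power_sum_diff_le[of "{..<u}" g]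
    by (simp add: E EY num divide_right_mono)
  have "variance (mersenne_estimate u r b h f) = variance (pair_sum g K)"
    unfolding E by (intro Bochner_Integration.integral_cong refl) (simp add: estimate)
  also have "\<dots> = 2 * ((\<Sum>t<r. (real (bucket_size b r t))\<^sup>2) / real p ^ 2 - (1 / (real p)\<^sup>2)\<^sup>2) *
      ((?P 2)\<^sup>2 - ?P 4) +
      4 * (real (bucket_size b r 0) / real p ^ 3 - (1 / (real p)\<^sup>2)\<^sup>2) * triple_sum {..<u} g"
  proof (subst variance_pair_sum)
    show "K v w = K w v" for v w
      by (auto simp: K_def sign_kernel_def)
  qed (use sum_sign_kernel_sq[OF b r0] sum_sign_kernel_row_sq[OF b, of r] in
      \<open>simp add: mean K_def[symmetric] assms(5)[symmetric] del: One_nat_def\<close>)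
  finally have var: "variance (mersenne_estimate u r b h f) = \<dots>" .
  have "variance (mersenne_estimate u r b h f) < 2 * (1 + (real r / 2 ^ b)\<^sup>2) * (?P 2)\<^sup>2 / real r"
    if nonzero: "\<exists>x<u. f x \<noteq> 0"
  proof -
    obtain x where x: "x < u" "g x \<noteq> 0" using nonzero by (auto simp: g_def)
    have P2: "0 < ?P 2"
      unfolding power_sum_def using x by (intro sum_pos2[of _ x]) auto
    let ?n = "card {x \<in> {..<u}. g x \<noteq> 0}"
    have n1: "1 \<le> ?n" using x by (simp add: Suc_le_eq card_gt_0_iff) blast
    \<comment> \<open>The power of two enters here: \<open>2 ^ k < 2 ^ b\<close> leaves a whole
      factor 2, so \<open>2 * u \<le> 2 ^ b\<close>, and with \<open>r \<le> u / 2\<close> also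
      \<open>4 * r \<le> 2 ^ b\<close>.\<close>
    obtain k where k: "u = 2 ^ k" using assms(2) by blast
    then have "(2::nat) ^ k < 2 ^ b" using assms(5,7) by linarith
    then have "k \<le> b - 1" by simp
    then have "u \<le> 2 ^ (b - 1)" unfolding k by (intro power_increasing) auto
    then have u: "2 * u \<le> 2 ^ b" using b by (cases b) auto
    have n2: "real ?n = 1 \<or> 2 \<le> real ?n"
    proof (cases "?n = 1")
      case False
      with n1 have "2 \<le> ?n" by linarith
      then have "real 2 \<le> real ?n" by (rule of_nat_mono)
      then show ?thesis by simp
    qed simp
    have nu: "?n \<le> u" using card_mono[of "{..<u}" "{x \<in> {..<u}. g x \<noteq> 0}"] by auto
    have "real (2 * u) \<le> real (2 ^ b)" using u by (simp only: of_nat_le_iff)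
    then have ru: "2 * real u \<le> 2 ^ b" by simp
    have p: "real p = 2 ^ b - 1" by (simp add: assms(5) of_nat_diff)
    have "real_of_int (int r * (\<Sum>t<r. (int (bucket_size b r t))\<^sup>2)) \<le>
        real_of_int ((2 ^ b - 1)\<^sup>2 + int r * (int r - 1))"
      using sum_bucket_size_squares_le[OF b r0] by (simp only: of_int_le_iff)
    then have Q: "real r * (\<Sum>t<r. (real (bucket_size b r t))\<^sup>2) \<le> (real p)\<^sup>2 + real r * (real r - 1)"
      by (simp add: p)
    have "real (r * bucket_size b r 0) \<le> real (2 ^ b + r)"
      using bucket_size_0_bounds(2)[OF b r0] by (simp only: of_nat_le_iff)
    then have N: "real r * real (bucket_size b r 0) \<le> 2 ^ b + real r" by simp
    show ?thesis
      unfolding var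
    proof (rule sketch_variance_bound[where n = "real ?n", OF _ _ p _ _ _ Q _ N refl refl P2])
      show "1 < real r" using assms(3) by simp
      show "4 * real r \<le> 2 ^ b" using ru assms(4) by simp
      show "1 \<le> real ?n" using n1 by simp
      show "2 * real ?n \<le> 2 ^ b" using ru nu by linarith
      show "real ?n = 1 \<or> 2 \<le> real ?n" by (rule n2)
      show "1 \<le> real (bucket_size b r 0)" using bucket_size_0_bounds(1)[OF b r0] by simp
      show "?P 4 \<le> (?P 2)\<^sup>2" by (rule power_sum_4_le) simp
      show "(?P 2)\<^sup>2 \<le> real ?n * ?P 4" by (rule power_sum_2_sq_le) simp
      show "triple_sum {..<u} g \<le> (real ?n - 2) * ((?P 2)\<^sup>2 - ?P 4)" by (rule triple_sum_le) simp
    qed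
  qed
  with E EY bias show ?thesis unfolding freq by simp
qed

end
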